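(* Let $n\ge 1$ be an integer, let $\Sigma$ be a symmetric positive definite real $(n+1)\times(n+1)$ matrix and let $\boldsymbol{\mu}=(\boldsymbol{\mu}_1,\ldots,\boldsymbol{\mu}_{n+1})\in\mathbb{R}^{n+1}$. Let $L_{\boldsymbol{\mu},\Sigma}$ be the log-normal distribution on $(\mathbb{R}_+^* )^{n+1}$, let $H_{n+1}:(\mathbb{R}_+^* )^{n+1}\to C_n$ be the homogeneous transform, and let $\mu_{C_n}$ be the reference measure on $C_n$ (all defined in the context). Then the pushforward $(H_{n+1})_*L_{\boldsymbol{\mu},\Sigma}$ is absolutely continuous with respect to $\mu_{C_n}$, and its Radon-Nikodým derivative is $$\frac{d\big((H_{n+1})_*L_{\boldsymbol{\mu},\Sigma}\big)}{d\mu_{C_n}}=g_{\boldsymbol{\mu},\Sigma},$$ where $g_{\boldsymbol{\mu},\Sigma}:C_n\to\mathbb{R}$ is the function such that, for all $(x_1,\ldots,x_n)\in B_n$, $$(g_{\boldsymbol{\mu},\Sigma}\circ \mathcal{C}_n)(x_1,\ldots,x_n)=\frac{\sqrt{2\pi V}}{Q\sqrt{n+1}}\exp\left(-\frac12\left[Y-V X^2\right]\right),$$ with, writing $\mathbf{1}\in\mathbb{R}^{n+1}$ for the column vector all of whose entries are $1$ and $w=w(x_1,\ldots,x_n)\in\mathbb{R}^{n+1}$ for the column vector with entries $w_i=\ln(x_i)-\boldsymbol{\mu}_i$ for $1\le i\le n$ and $w_{n+1}=\ln\left(1-\sum_{i=1}^n x_i\right)-\boldsymbol{\mu}_{n+1}$,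 $$V=\left(\mathbf{1}^{T}\Sigma^{-1}\mathbf{1}\right)^{-1},\qquad Q=\sqrt{|\det\Sigma|}\,(2\pi)^{\frac{n+1}{2}}\left(1-\sum_{i=1}^n x_i\right)\prod_{i=1}^n x_i,\qquad X=\mathbf{1}^{T}\Sigma^{-1}w,\qquad Y=w^{T}\Sigma^{-1}w .$$
   Context: $\mathbb{R}_+^*=\,]0,+\infty[$, and $\lambda_{\mathbb{R}^m}$ is Lebesgue measure on $\mathbb{R}^m$ (or its restriction to a Borel subset). All measures are on Borel $\sigma$-algebras, and the pushforward is $\Phi_*\mu(E)=\mu(\Phi^{-1}(E))$. $B_n=\{(x_1,\ldots,x_n)\in\,]0,1[^n : \sum_{i=1}^n x_i<1\}$. $C_n=\{(y_1,\ldots,y_{n+1})\in\mathbb{R}^{n+1}: 0<y_i<1 \text{ for all } i,\ \sum_{i=1}^{n+1}y_i=1\}$. $\mathcal{C}_n:B_n\to C_n$ is the bijection $\mathcal{C}_n(x_1,\ldots,x_n)=(x_1,\ldots,x_n,1-\sum_{i=1}^n x_i)$. The measure $\mu_{C_n}$ on $C_n$ is $\mu_{C_n}=(\mathcal{C}_n)_*\big(\sqrt{n+1}\,\lambda_{\mathbb{R}^n}|_{B_n}\big)$ (the surface measure on $C_n$). The homogeneous transform is $H_{n+1}:(\mathbb{R}_+^* )^{n+1}\to C_n$, $H_{n+1}(y_1,\ldots,y_{n+1})=\left(\frac{y_1}{\sum_{i=1}^{n+1}y_i},\ldots,\frac{y_{n+1}}{\sum_{i=1}^{n+1}y_i}\right)$.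 The log-normal distribution is the probability measure $L_{\boldsymbol{\mu},\Sigma}=f_{\boldsymbol{\mu},\Sigma}\,\lambda_{\mathbb{R}^{n+1}}$ on $(\mathbb{R}_+^* )^{n+1}$, where $$f_{\boldsymbol{\mu},\Sigma}(y_1,\ldots,y_{n+1})=\frac{\exp\left(-\frac12 z^{T}\Sigma^{-1}z\right)}{\sqrt{|\det\Sigma|}\,(2\pi)^{\frac{n+1}{2}}\prod_{i=1}^{n+1}y_i},\qquad z=(\ln(y_i)-\boldsymbol{\mu}_i)_{1\le i\le n+1}\ \text{(column vector)}.$$ *)

theory Defs
  imports "HOL-Analysis.Analysis"
begin

text \<open>
  Coordinates of \<open>\<real>\<^sup>n\<close> are indexed by a finite type \<open>'n\<close> with \<open>n = CARD('n)\<close>, and coordinates of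
  \<open>\<real>\<close> to the power \<open>n + 1\<close> by \<open>'n option\<close>: \<open>Some i\<close> is the \<open>i\<close>-th of the first \<open>n\<close> coordinates
  and \<open>None\<close> is the last one.  Since types are nonempty, \<open>n \<ge> 1\<close> holds automatically.
\<close>

definition open_corner_simplex :: "(real ^ 'n) set" where
  "open_corner_simplex = {x. (\<forall>i. 0 < x $ i \<and> x $ i < 1) \<and> (\<Sum>i\<in>UNIV. x $ i) < 1}"

definition open_unit_simplex :: "(real ^ ('n::finite) option) set" where
  "open_unit_simplex = {y. (\<forall>i. 0 < y $ i \<and> y $ i < 1) \<and> (\<Sum>i\<in>UNIV. y $ i) = 1}"

definition positive_orthant :: "(real ^ 'm) set" where
  "positive_orthant = {y. \<forall>i. 0 < y $ i}"

definition simplex_completion :: "real ^ 'n \<Rightarrow> real ^ ('n::finite) option" where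
  "simplex_completion x = (\<chi> k. case k of Some i \<Rightarrow> x $ i | None \<Rightarrow> 1 - (\<Sum>i\<in>UNIV. x $ i))"

definition simplex_measure :: "(real ^ ('n::finite) option) measure" where
  "simplex_measure =
     distr (density (restrict_space lborel (open_corner_simplex :: (real ^ 'n) set))
                    (\<lambda>_. ennreal (sqrt (real CARD('n) + 1))))
           (restrict_space borel open_unit_simplex)
           simplex_completion"

definition homogeneous_transform :: "real ^ 'm \<Rightarrow> real ^ 'm" where
  "homogeneous_transform y = (\<chi> k. y $ k / (\<Sum>i\<in>UNIV. y $ i))"

definition positive_definite :: "real ^ 'm ^ 'm \<Rightarrow> bool" where
  "positive_definite A \<longleftrightarrow> (\<forall>x. x \<noteq> 0 \<longrightarrow> 0 < x \<bullet> (A *v x))"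

definition lognormal_density :: "real ^ 'm \<Rightarrow> real ^ 'm ^ 'm \<Rightarrow> real ^ 'm \<Rightarrow> real" where
  "lognormal_density m \<Sigma> y =
     (let z = (\<chi> i. ln (y $ i) - m $ i) in
      exp (- (1 / 2) * (z \<bullet> (matrix_inv \<Sigma> *v z))) /
      (sqrt \<bar>det \<Sigma>\<bar> * (2 * pi) powr (real CARD('m) / 2) * (\<Prod>i\<in>UNIV. y $ i)))"

definition lognormal_distribution :: "real ^ 'm \<Rightarrow> real ^ 'm ^ 'm \<Rightarrow> (real ^ 'm) measure" where
  "lognormal_distribution m \<Sigma> =
     density (restrict_space lborel positive_orthant) (\<lambda>y. ennreal (lognormal_density m \<Sigma> y))"

lemma sum_UNIV_option: "(\<Sum>k\<in>UNIV. f k) = f None + (\<Sum>i\<in>UNIV. f (Some i))"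
  for f :: "'n::finite option \<Rightarrow> real"
  by (simp add: UNIV_option_conv sum.reindex)

lemma bij_betw_simplex_completion:
  "bij_betw simplex_completion (open_corner_simplex :: (real ^ 'n) set) open_unit_simplex"
proof (rule bij_betw_byWitness[where f' = "\<lambda>y. \<chi> i. y $ Some i"])
  show "\<forall>x\<in>open_corner_simplex. (\<chi> i. simplex_completion x $ Some i) = (x :: real ^ 'n)"
    by (simp add: simplex_completion_def vec_eq_iff)
  show "\<forall>y\<in>open_unit_simplex. simplex_completion (\<chi> i. y $ Some i) = (y :: real ^ ('n::finite) option)"
    by (auto simp: simplex_completion_def open_unit_simplex_def vec_eq_iff sum_UNIV_option
             split: option.split)
  have "0 < (\<Sum>i\<in>UNIV. x $ i)" if "\<forall>i. 0 < x $ i" for x :: "real ^ 'n"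
    using that by (intro sum_pos) auto
  then show "simplex_completion ` (open_corner_simplex :: (real ^ 'n) set) \<subseteq> open_unit_simplex"
    by (auto simp: simplex_completion_def open_corner_simplex_def open_unit_simplex_def
        sum_UNIV_option split: option.split)
  show "(\<lambda>y. \<chi> i. y $ Some i) ` open_unit_simplex \<subseteq> (open_corner_simplex :: (real ^ 'n) set)"
  proof (clarsimp simp: open_unit_simplex_def open_corner_simplex_def sum_UNIV_option)
    fix y :: "real ^ ('n::finite) option"
    assume "\<forall>i. 0 < y $ i \<and> y $ i < 1" "y $ None + (\<Sum>i\<in>UNIV. y $ Some i) = 1"
    then show "(\<Sum>i\<in>UNIV. y $ Some i) < 1"
      by (smt (verit))
  qed
qed

lemma homogeneous_transform_in_simplex:
  assumes "y \<in> positive_orthant"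
  shows "homogeneous_transform y \<in> (open_unit_simplex :: (real ^ ('n::finite) option) set)"
proof -
  have pos: "0 < y $ i" for i
    using assms by (simp add: positive_orthant_def)
  have S: "0 < (\<Sum>i\<in>UNIV. y $ i)"
    using pos by (intro sum_pos) auto
  have "y $ k < (\<Sum>i\<in>UNIV. y $ i)" for k
  proof -
    obtain l where "l \<noteq> k"
      by (metis option.distinct(1))
    then have "0 < (\<Sum>i\<in>UNIV - {k}. y $ i)"
      using pos by (intro sum_pos) auto
    then show ?thesis
      by (simp add: sum.remove[of UNIV k])
  qed
  then show ?thesis
    using S pos
    by (auto simp: open_unit_simplex_def homogeneous_transform_def sum_divide_distrib[symmetric])
qed

lemma measurable_simplex_completion [measurable]:
  "simplex_completion \<in> restrict_space lborel (open_corner_simplex :: (real ^ 'n) set)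
     \<rightarrow>\<^sub>M restrict_space borel open_unit_simplex"
proof (rule measurable_restrict_space3)
  have "continuous_on UNIV (\<lambda>x :: real ^ 'n. simplex_completion x $ k)" for k
    by (cases k) (auto simp: simplex_completion_def intro!: continuous_intros)
  then have "continuous_on UNIV (\<lambda>x :: real ^ 'n. \<chi> k. simplex_completion x $ k)"
    by (intro continuous_on_vec_lambda)
  then have "continuous_on UNIV (simplex_completion :: real ^ 'n \<Rightarrow> _)"
    by simp
  then show "(simplex_completion :: real ^ 'n \<Rightarrow> _) \<in> lborel \<rightarrow>\<^sub>M borel"
    by (simp add: borel_measurable_continuous_onI)
  show "simplex_completion \<in> (open_corner_simplex :: (real ^ 'n) set) \<rightarrow> open_unit_simplex"
    using bij_betw_simplex_completion bij_betw_apply by fastforce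
qed

lemma measurable_homogeneous_transform [measurable]:
  "homogeneous_transform \<in> restrict_space lborel positive_orthant
     \<rightarrow>\<^sub>M restrict_space borel (open_unit_simplex :: (real ^ ('n::finite) option) set)"
proof (rule measurable_restrict_space2)
  show "homogeneous_transform \<in> space (restrict_space lborel positive_orthant)
      \<rightarrow> (open_unit_simplex :: (real ^ ('n::finite) option) set)"
    by (auto simp: space_restrict_space intro: homogeneous_transform_in_simplex)
  have "(\<Sum>i\<in>UNIV. y $ i) \<noteq> 0" if "y \<in> positive_orthant" for y :: "real ^ ('n::finite) option"
  proof -
    have "0 < (\<Sum>i\<in>UNIV. y $ i)"
      using that by (intro sum_pos) (auto simp: positive_orthant_def)
    then show ?thesis by simp
  qed
  then have "continuous_on positive_orthant (homogeneous_transform :: real ^ ('n::finite) option \<Rightarrow> _)"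
    unfolding homogeneous_transform_def by (intro continuous_intros continuous_on_vec_lambda) auto
  then have "homogeneous_transform \<in> borel_measurable
      (restrict_space borel (positive_orthant :: (real ^ ('n::finite) option) set))"
    by (rule borel_measurable_continuous_on_restrict)
  then show "homogeneous_transform \<in> borel_measurable
      (restrict_space lborel (positive_orthant :: (real ^ ('n::finite) option) set))"
    by (simp cong: measurable_cong_sets add: sets_restrict_space)
qed

end

theory Submission
  imports Defs "HOL-Probability.Distributions"
begin

text \<open>
  Write \<open>C\<close> for the completion map \<open>B\<^sub>n \<rightarrow> C\<^sub>n\<close>.  Every point of the positive orthant is
  \<open>t C(x)\<close> for exactly one \<open>t > 0\<close> and \<open>x \<in> B\<^sub>n\<close>, and the homogeneous transform sends it to
  \<open>C(x)\<close>.  The pushforward therefore has a density that is obtained by integrating the log-normal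
  density along the ray through \<open>C(x)\<close>.

  In the coordinates \<open>(x, t)\<close> Lebesgue measure on the orthant is \<open>t\<^sup>n dx dt\<close>
  (\<open>nn_integral_homogeneous_coordinates\<close>).  No Jacobian determinant has to be computed:
  replacing the last coordinate by the sum of all coordinates is a translation in that coordinate, and
  for a fixed sum \<open>t\<close> the other \<open>n\<close> coordinates are scaled by \<open>t\<close>, so Tonelli's theorem and
  the behaviour of Lebesgue measure under translations and homotheties suffice.

  On a ray the substitution \<open>t = exp u\<close> moves the vector of logarithms along the line
  \<open>w + u 1\<close>.  The factor \<open>t\<^sup>n\<close>, the factor \<open>t\<close> from \<open>dt = exp u du\<close> and the factor
  \<open>t\<close> to the power \<open>-(n+1)\<close> from the product in the denominator of the density cancel, which leaves
  the exponential of a quadratic polynomial in \<open>u\<close>.  Completing the square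
  (\<open>complete_square_along_ones\<close>) shows that it is a Gaussian with variance \<open>V\<close> and total mass
  \<open>sqrt (2 \<pi> V) exp (-(Y - V X\<^sup>2) / 2)\<close>, up to the constant \<open>1 / Q\<close>
  (\<open>nn_integral_lognormal_density_ray\<close>).  The remaining factor \<open>1 / sqrt (n + 1)\<close> in \<open>g\<close>
  compensates the normalisation of the surface measure.  That measure is finite, so its
  Radon-Nikodym derivatives are unique up to null sets.
\<close>

section \<open>Lebesgue measure in homogeneous coordinates\<close>

lemma borel_measurable_vec_nth [measurable]: "(\<lambda>x :: real ^ 'n. x $ i) \<in> borel_measurable borel"
  by (intro borel_measurable_continuous_onI continuous_intros)

lemma borel_measurable_vecI:
  fixes f :: "'a \<Rightarrow> real ^ 'n"
  assumes "\<And>i. (\<lambda>x. f x $ i) \<in> borel_measurable M"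
  shows "f \<in> borel_measurable M"
  using assms
  by (subst borel_measurable_euclidean_space) (auto simp: Basis_vec_def inner_axis)

definition append_coordinate :: "real ^ 'n \<Rightarrow> real \<Rightarrow> real ^ ('n::finite) option" where
  "append_coordinate x s = (\<chi> k. case k of Some i \<Rightarrow> x $ i | None \<Rightarrow> s)"

lemma append_coordinate_nth [simp]:
  "append_coordinate x s $ Some i = x $ i" "append_coordinate x s $ None = s"
  by (simp_all add: append_coordinate_def)

lemma simplex_completion_nth [simp]:
  "simplex_completion x $ Some i = x $ i" "simplex_completion x $ None = 1 - (\<Sum>i\<in>UNIV. x $ i)"
  by (simp_all add: simplex_completion_def)

lemma measurable_append_coordinate [measurable]:
  fixes f :: "'a \<Rightarrow> real ^ 'n::finite"
  assumes [measurable]: "f \<in> borel_measurable M" "g \<in> borel_measurable M"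
  shows "(\<lambda>z. append_coordinate (f z) (g z)) \<in> borel_measurable M"
proof (rule borel_measurable_vecI)
  show "(\<lambda>z. append_coordinate (f z) (g z) $ k) \<in> borel_measurable M" for k
    by (cases k) simp_all
qed

lemma borel_measurable_simplex_completion [measurable]:
  "(simplex_completion :: real ^ 'n::finite \<Rightarrow> _) \<in> borel_measurable borel"
proof (rule borel_measurable_vecI)
  show "(\<lambda>x :: real ^ 'n. simplex_completion x $ k) \<in> borel_measurable borel" for k
    by (cases k) simp_all
qed

lemma prod_Basis_vec:
  fixes v :: "real ^ 'n"
  shows "(\<Prod>b\<in>Basis. v \<bullet> b) = (\<Prod>i\<in>UNIV. v $ i)"
  by (simp add: Basis_vec_def cart_eq_inner_axis axis_eq_axis prod.UNION_disjoint)

lemma prod_UNIV_option: "(\<Prod>k\<in>UNIV. f k) = f None * (\<Prod>i\<in>UNIV. f (Some i))"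
  for f :: "'n::finite option \<Rightarrow> real"
  by (simp add: UNIV_option_conv prod.reindex)

text \<open>
  Lebesgue measure is determined by its values on boxes, and a box in \<open>n + 1\<close> coordinates is the
  product of a box in the first \<open>n\<close> coordinates with an interval.
\<close>

lemma lborel_append_coordinate:
  "(lborel :: (real ^ ('n::finite) option) measure) =
     distr (lborel \<Otimes>\<^sub>M lborel) borel (\<lambda>(x, s). append_coordinate x s)"
proof (rule lborel_eqI)
  fix l u :: "real ^ ('n::finite) option"
  assume le: "\<And>b. b \<in> Basis \<Longrightarrow> l \<bullet> b \<le> u \<bullet> b"
  have lu: "l $ k \<le> u $ k" for k
    using le[of "axis k 1"] by (simp add: inner_axis)
  define l' u' where "l' = (\<chi> i. l $ Some i)" and "u' = (\<chi> i. u $ Some i)"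
  have le': "l' \<bullet> b \<le> u' \<bullet> b" if "b \<in> Basis" for b
    using that lu by (auto simp: Basis_vec_def inner_axis l'_def u'_def)
  have "emeasure (distr (lborel \<Otimes>\<^sub>M lborel) borel (\<lambda>(x, s). append_coordinate x s)) (box l u)
      = emeasure (lborel \<Otimes>\<^sub>M lborel) ((\<lambda>(x, s). append_coordinate x s) -` box l u)"
    by (subst emeasure_distr) (auto simp: space_pair_measure)
  also have "(\<lambda>(x, s). append_coordinate x s) -` box l u = box l' u' \<times> box (l $ None) (u $ None)"
  proof -
    have "append_coordinate x s \<in> box l u \<longleftrightarrow> x \<in> box l' u' \<and> s \<in> box (l $ None) (u $ None)" for x s
      by (auto simp: mem_box_cart l'_def u'_def split_option_all)
    then show ?thesis by auto
  qed
  also have "emeasure (lborel \<Otimes>\<^sub>M lborel) \<dots> = emeasure lborel (box l' u') * emeasure lborel (box (l $ None) (u $ None))"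
    by (rule lborel.emeasure_pair_measure_Times) auto
  also have "\<dots> = ennreal (\<Prod>i\<in>UNIV. (u' - l') $ i) * ennreal (u $ None - l $ None)"
    using le' lu by (simp add: prod_Basis_vec)
  also have "\<dots> = ennreal (\<Prod>b\<in>Basis. (u - l) \<bullet> b)"
    using lu
    by (simp add: prod_Basis_vec prod_UNIV_option l'_def u'_def mult.commute
        ennreal_mult[symmetric] prod_nonneg)
  finally show "emeasure (distr (lborel \<Otimes>\<^sub>M lborel) borel (\<lambda>(x, s). append_coordinate x s)) (box l u)
      = ennreal (\<Prod>b\<in>Basis. (u - l) \<bullet> b)" .
qed simp

lemma nn_integral_append_coordinate:
  fixes F :: "real ^ ('n::finite) option \<Rightarrow> ennreal"
  assumes [measurable]: "F \<in> borel_measurable borel"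
  shows "(\<integral>\<^sup>+ y. F y \<partial>lborel) = (\<integral>\<^sup>+ x. \<integral>\<^sup>+ s. F (append_coordinate x s) \<partial>lborel \<partial>lborel)"
  by (subst lborel_append_coordinate)
     (simp add: nn_integral_distr lborel.nn_integral_fst[symmetric])

lemma nn_integral_lborel_scaleR:
  fixes f :: "'a::euclidean_space \<Rightarrow> ennreal"
  assumes [measurable]: "f \<in> borel_measurable borel" and "c \<noteq> 0"
  shows "(\<integral>\<^sup>+ x. f x \<partial>lborel) = ennreal (\<bar>c\<bar> ^ DIM('a)) * (\<integral>\<^sup>+ x. f (c *\<^sub>R x) \<partial>lborel)"
  by (subst lborel_affine[OF \<open>c \<noteq> 0\<close>, of 0])
     (simp add: nn_integral_density nn_integral_distr nn_integral_cmult)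

lemma positive_orthant_borel [measurable]: "(positive_orthant :: (real ^ 'n) set) \<in> sets borel"
  unfolding positive_orthant_def by measurable

lemma open_corner_simplex_borel [measurable]:
  "(open_corner_simplex :: (real ^ 'n) set) \<in> sets borel"
  unfolding open_corner_simplex_def by measurable

lemma open_unit_simplex_borel [measurable]:
  "(open_unit_simplex :: (real ^ ('n::finite) option) set) \<in> sets borel"
  unfolding open_unit_simplex_def by measurable

text \<open>
  If all \<open>n + 1\<close> coordinates are positive, then each \<open>x\<^sub>i\<close> is at most the sum of the
  \<open>x\<^sub>j\<close>, and the positive last coordinate keeps this sum below \<open>1\<close>.
\<close>

lemma scaleR_simplex_completion_in_positive_orthant_iff:
  fixes x :: "real ^ 'n::finite"
  assumes "0 < t"
  shows "t *\<^sub>R simplex_completion x \<in> positive_orthant \<longleftrightarrow> x \<in> open_corner_simplex"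
proof -
  have "x $ i < 1" if "\<forall>i. 0 < x $ i" "(\<Sum>i\<in>UNIV. x $ i) < 1" for i
  proof -
    have "x $ i \<le> (\<Sum>i\<in>UNIV. x $ i)"
      using that(1) by (intro member_le_sum) (auto intro: less_imp_le)
    with that(2) show ?thesis by simp
  qed
  then show ?thesis
    using assms
    by (auto simp: positive_orthant_def open_corner_simplex_def split_option_all zero_less_mult_iff)
qed

text \<open>
  The change of variables \<open>y = t C(x)\<close>, in which \<open>t\<close> is the sum of the coordinates of \<open>y\<close>.
  It is the composition of a translation of the last coordinate, which introduces \<open>t\<close> with the
  first \<open>n\<close> coordinates held fixed, and a homothety by \<open>t\<close> of these \<open>n\<close> coordinates, which
  is the source of the factor \<open>t\<^sup>n\<close>.
\<close>

proposition nn_integral_homogeneous_coordinates: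
  fixes F :: "real ^ ('n::finite) option \<Rightarrow> ennreal"
  assumes [measurable]: "F \<in> borel_measurable borel"
  shows "(\<integral>\<^sup>+ y. F y * indicator positive_orthant y \<partial>lborel) =
     (\<integral>\<^sup>+ x. (\<integral>\<^sup>+ t. ennreal (t ^ CARD('n)) * F (t *\<^sub>R simplex_completion x) * indicator {0<..} t \<partial>lborel)
        * indicator open_corner_simplex x \<partial>lborel)"
proof -
  define G where "G y = F y * indicator positive_orthant y" for y
  have [measurable]: "G \<in> borel_measurable borel"
    unfolding G_def by measurable
  \<comment> \<open>The coordinates of a point of the orthant have a positive sum, so only \<open>t > 0\<close> contributes,
    and for such \<open>t\<close> the homothety by \<open>t\<close> is invertible.\<close>
  have G_0: "G (append_coordinate x (t - (\<Sum>i\<in>UNIV. x $ i))) = 0" if "t \<le> 0" for x and t :: real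
  proof -
    have "\<not> (0 < t - (\<Sum>i\<in>UNIV. x $ i))" if "\<forall>i. 0 < x $ i"
    proof -
      have "0 \<le> (\<Sum>i\<in>UNIV. x $ i)"
        using that by (intro sum_nonneg) (auto intro: less_imp_le)
      with \<open>t \<le> 0\<close> show ?thesis by simp
    qed
    then have "append_coordinate x (t - (\<Sum>i\<in>UNIV. x $ i)) \<notin> positive_orthant"
      by (auto simp: positive_orthant_def split_option_all)
    then show ?thesis by (simp add: G_def)
  qed
  have ray: "append_coordinate (t *\<^sub>R x) (t - (\<Sum>i\<in>UNIV. (t *\<^sub>R x) $ i)) = t *\<^sub>R simplex_completion x"
    for x :: "real ^ 'n" and t
    by (simp add: vec_eq_iff split_option_all sum_distrib_left right_diff_distrib)
  have "(\<integral>\<^sup>+ y. G y \<partial>lborel) = (\<integral>\<^sup>+ x. \<integral>\<^sup>+ s. G (append_coordinate x s) \<partial>lborel \<partial>lborel)"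
    by (rule nn_integral_append_coordinate) measurable
  also have "\<dots> = (\<integral>\<^sup>+ x. \<integral>\<^sup>+ t. G (append_coordinate x (t - (\<Sum>i\<in>UNIV. x $ i))) \<partial>lborel \<partial>lborel)"
  proof (rule nn_integral_cong)
    fix x :: "real ^ 'n"
    show "(\<integral>\<^sup>+ s. G (append_coordinate x s) \<partial>lborel) =
        (\<integral>\<^sup>+ t. G (append_coordinate x (t - (\<Sum>i\<in>UNIV. x $ i))) \<partial>lborel)"
      by (subst nn_integral_real_affine[where c = 1 and t = "- (\<Sum>i\<in>UNIV. x $ i)"]) simp_all
  qed
  also have "\<dots> = (\<integral>\<^sup>+ t. \<integral>\<^sup>+ x. G (append_coordinate x (t - (\<Sum>i\<in>UNIV. x $ i))) \<partial>lborel \<partial>lborel)"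
    by (rule lborel_pair.Fubini'[symmetric]) measurable
  also have "\<dots> = (\<integral>\<^sup>+ t. \<integral>\<^sup>+ x. ennreal (t ^ CARD('n)) * G (t *\<^sub>R simplex_completion x)
                       * indicator {0<..} t \<partial>lborel \<partial>lborel)"
  proof (rule nn_integral_cong)
    fix t :: real
    show "(\<integral>\<^sup>+ x. G (append_coordinate x (t - (\<Sum>i\<in>UNIV. x $ i))) \<partial>lborel) =
       (\<integral>\<^sup>+ x. ennreal (t ^ CARD('n)) * G (t *\<^sub>R simplex_completion x) * indicator {0<..} t \<partial>lborel)"
    proof (cases "0 < t")
      case True
      then show ?thesis
        by (subst nn_integral_lborel_scaleR[where c = t])
           (simp_all only: ray, simp_all add: nn_integral_cmult)
    qed (simp add: G_0)
  qed
  also have "\<dots> = (\<integral>\<^sup>+ x. \<integral>\<^sup>+ t. ennreal (t ^ CARD('n)) * G (t *\<^sub>R simplex_completion x)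
                       * indicator {0<..} t \<partial>lborel \<partial>lborel)"
    by (rule lborel_pair.Fubini') measurable
  also have "\<dots> = (\<integral>\<^sup>+ x. (\<integral>\<^sup>+ t. ennreal (t ^ CARD('n)) * F (t *\<^sub>R simplex_completion x)
                       * indicator {0<..} t \<partial>lborel) * indicator open_corner_simplex x \<partial>lborel)"
    by (subst nn_integral_multc[symmetric], measurable, intro nn_integral_cong)
       (auto simp: G_def scaleR_simplex_completion_in_positive_orthant_iff split: split_indicator)
  finally show ?thesis
    by (simp add: G_def)
qed

section \<open>Integrating the log-normal density along a ray\<close>

text \<open>
  The substitution rule on compact intervals is applied to \<open>[-k, k]\<close> and its image under the
  exponential function; monotone convergence gives the two unbounded domains.
\<close>

lemma nn_integral_exp_substitution:
  fixes f :: "real \<Rightarrow> ennreal"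
  assumes [measurable]: "f \<in> borel_measurable borel"
  shows "(\<integral>\<^sup>+ t. f t * indicator {0<..} t \<partial>lborel) = (\<integral>\<^sup>+ u. f (exp u) * ennreal (exp u) \<partial>lborel)"
proof -
  have ind_mono: "incseq (\<lambda>k. \<lambda>x. h x * indicator (A k) x)" if "incseq A"
    for h :: "real \<Rightarrow> ennreal" and A :: "nat \<Rightarrow> real set"
    using that by (fastforce simp: incseq_def le_fun_def split: split_indicator)
  have sup_ind: "(SUP k. h x * indicator (A k) x) = h x * indicator (\<Union>k. A k) x"
    for h :: "real \<Rightarrow> ennreal" and A :: "nat \<Rightarrow> real set" and x
  proof (cases "x \<in> (\<Union>k. A k)")
    case True
    then obtain k where "x \<in> A k" by auto
    then have "(SUP k. h x * indicator (A k) x) = h x"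
      by (intro antisym SUP_least SUP_upper2[of k]) (auto split: split_indicator)
    with True show ?thesis by simp
  qed simp
  \<comment> \<open>The index starts at \<open>1\<close> so that none of the intervals degenerates to a point.\<close>
  define I J :: "nat \<Rightarrow> real set"
    where "I k = {exp (- real (Suc k))..exp (real (Suc k))}" and "J k = {- real (Suc k)..real (Suc k)}"
    for k
  have inc: "incseq I" "incseq J"
    by (auto simp: incseq_def I_def J_def intro: order_trans)
  have J: "(\<Union>k. J k) = UNIV"
  proof -
    have "x \<in> J (nat \<lceil>\<bar>x\<bar>\<rceil>)" for x
      by (auto simp: J_def) linarith+
    then show ?thesis by auto
  qed
  have "I k = exp ` J k" for k
  proof -
    have "x \<in> exp ` J k" if "x \<in> I k" for x
    proof -
      from that have "0 < x"
        unfolding I_def by (metis atLeastAtMost_iff exp_gt_zero less_le_trans)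
      then obtain u where "x = exp u"
        by (metis exp_total)
      with that show ?thesis by (simp add: I_def J_def)
    qed
    then show ?thesis by (auto simp: I_def J_def)
  qed
  moreover have "range exp = {0::real<..}"
    using exp_total exp_gt_zero by blast
  ultimately have I: "(\<Union>k. I k) = {0<..}"
    using J by (simp add: image_UN[symmetric])
  have [measurable]: "I k \<in> sets borel" "J k \<in> sets borel" for k
    by (simp_all add: I_def J_def)
  have "(\<integral>\<^sup>+ t. f t * indicator {0<..} t \<partial>lborel) = (SUP k. \<integral>\<^sup>+ t. f t * indicator (I k) t \<partial>lborel)"
    unfolding I[symmetric] sup_ind[symmetric]
    by (rule nn_integral_monotone_convergence_SUP[OF ind_mono[OF inc(1)]]) measurable
  also have "\<dots> = (SUP k. \<integral>\<^sup>+ u. f (exp u) * ennreal (exp u) * indicator (J k) u \<partial>lborel)"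
  proof (rule SUP_cong)
    fix k
    show "(\<integral>\<^sup>+ t. f t * indicator (I k) t \<partial>lborel) =
        (\<integral>\<^sup>+ u. f (exp u) * ennreal (exp u) * indicator (J k) u \<partial>lborel)"
      unfolding I_def J_def
      by (intro nn_integral_substitution_aux) (auto intro!: derivative_eq_intros continuous_intros)
  qed simp
  also have "\<dots> = (\<integral>\<^sup>+ u. f (exp u) * ennreal (exp u) \<partial>lborel)"
    using nn_integral_monotone_convergence_SUP[OF ind_mono[OF inc(2)],
        of "\<lambda>u. f (exp u) * ennreal (exp u)" lborel]
    by (simp add: sup_ind[where A = J and h = "\<lambda>u. f (exp u) * ennreal (exp u)"] J)
  finally show ?thesis .
qed

lemma nn_integral_gaussian:
  assumes "0 < v"
  shows "(\<integral>\<^sup>+ u. ennreal (exp (- ((u - \<mu>)\<^sup>2) / (2 * v))) \<partial>lborel) = ennreal (sqrt (2 * pi * v))"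
proof -
  have "exp (- ((u - \<mu>)\<^sup>2) / (2 * v)) = sqrt (2 * pi * v) * normal_density \<mu> (sqrt v) u" for u
    using assms by (simp add: normal_density_def)
  moreover have "(\<integral>\<^sup>+ u. ennreal (normal_density \<mu> (sqrt v) u) \<partial>lborel) = 1"
    using assms by (subst nn_integral_eq_integral) simp_all
  ultimately show ?thesis
    using assms by (simp add: ennreal_mult nn_integral_cmult)
qed

lemma matrix_mult_matrix_inv:
  fixes A :: "real ^ 'm ^ 'm"
  assumes "invertible A"
  shows "A *v (matrix_inv A *v x) = x"
proof -
  have "A ** matrix_inv A = mat 1"
    using someI_ex[of "\<lambda>B. A ** B = mat 1 \<and> B ** A = mat 1"] assms
    unfolding matrix_inv_def invertible_def by blast
  then show ?thesis
    by (simp add: matrix_vector_mul_assoc)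
qed

lemma inner_matrix_inv_commute:
  fixes A :: "real ^ 'm ^ 'm"
  assumes "transpose A = A" "invertible A"
  shows "x \<bullet> (matrix_inv A *v y) = y \<bullet> (matrix_inv A *v x)"
proof -
  have "(A *v u) \<bullet> v = u \<bullet> (A *v v)" for u v
    using assms(1) by (metis dot_lmul_matrix vector_transpose_matrix)
  from this[of "matrix_inv A *v x" "matrix_inv A *v y"] show ?thesis
    using assms(2) by (simp add: matrix_mult_matrix_inv inner_commute)
qed

lemma positive_definite_imp_invertible:
  fixes A :: "real ^ 'm ^ 'm"
  assumes "positive_definite A"
  shows "invertible A"
proof -
  have "x = 0" if "A *v x = 0" for x
    using assms that by (metis positive_definite_def inner_zero_right less_irrefl)
  then show ?thesis
    by (simp add: invertible_left_inverse matrix_left_invertible_ker)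
qed

text \<open>
  With \<open>x = A u\<close>, the quadratic form of the inverse at \<open>x\<close> is that of \<open>A\<close> at \<open>u\<close>.
\<close>

lemma positive_definite_matrix_inv:
  fixes A :: "real ^ 'm ^ 'm"
  assumes "positive_definite A"
  shows "positive_definite (matrix_inv A)"
  unfolding positive_definite_def
proof (intro allI impI)
  fix x :: "real ^ 'm"
  assume "x \<noteq> 0"
  define u where "u = matrix_inv A *v x"
  have x: "A *v u = x"
    using positive_definite_imp_invertible[OF assms] by (simp add: u_def matrix_mult_matrix_inv)
  with \<open>x \<noteq> 0\<close> have "u \<noteq> 0" by auto
  with assms have "0 < u \<bullet> (A *v u)"
    by (simp add: positive_definite_def)
  then have "0 < u \<bullet> x"
    by (simp only: x)
  then show "0 < x \<bullet> (matrix_inv A *v x)"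
    by (simp add: u_def inner_commute)
qed

text \<open>
  On the line \<open>z + u 1\<close> the quadratic form of \<open>S\<close> is a polynomial of degree two in \<open>u\<close> with
  leading coefficient \<open>1 / V\<close>.  It is written here around its critical point, so that the Gaussian
  integral applies with \<open>V\<close> as the variance.
\<close>

lemma complete_square_along_ones:
  fixes S :: "real ^ 'm ^ 'm"
  assumes sym: "\<And>x y. x \<bullet> (S *v y) = y \<bullet> (S *v x)" and "1 \<bullet> (S *v 1) \<noteq> 0"
  defines "V \<equiv> inverse (1 \<bullet> (S *v 1))"
  shows "(z + u *\<^sub>R 1) \<bullet> (S *v (z + u *\<^sub>R 1)) =
     (z \<bullet> (S *v z) - V * (1 \<bullet> (S *v z))\<^sup>2) + (u - (- V * (1 \<bullet> (S *v z))))\<^sup>2 / V"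
proof -
  define a where "a = 1 \<bullet> (S *v 1)"
  have a: "a \<noteq> 0" "V = inverse a"
    using assms by (auto simp: a_def)
  have "(z + u *\<^sub>R 1) \<bullet> (S *v (z + u *\<^sub>R 1)) = z \<bullet> (S *v z) + 2 * u * (1 \<bullet> (S *v z)) + u\<^sup>2 * a"
    using sym[of z 1]
    by (simp add: matrix_vector_right_distrib matrix_vector_mult_scaleR inner_add_left
        inner_add_right power2_eq_square a_def algebra_simps)
  then show ?thesis
    unfolding a(2) using a(1) by (simp add: field_simps power2_eq_square)
qed

lemma lognormal_density_borel [measurable]:
  "lognormal_density m \<Sigma> \<in> borel_measurable borel"
proof -
  have [measurable]: "(\<lambda>y. \<chi> i. ln (y $ i) - m $ i) \<in> borel_measurable borel"
    by (rule borel_measurable_vecI) simp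
  have [measurable]: "(*v) (matrix_inv \<Sigma>) \<in> borel_measurable borel"
    by (intro borel_measurable_continuous_onI linear_continuous_on) simp
  show ?thesis
    unfolding lognormal_density_def[abs_def] Let_def by measurable
qed

text \<open>
  The weight \<open>t\<close> to the power \<open>CARD('m) - 1\<close> is the Jacobian of the homogeneous coordinates in
  dimension \<open>CARD('m)\<close>.  The substitution \<open>t = exp u\<close> adds one more factor \<open>t\<close>, and together
  they cancel the power of \<open>t\<close> in the denominator of the density at \<open>t c\<close>, so that only a Gaussian
  in \<open>u\<close> is left.
\<close>

proposition nn_integral_lognormal_density_ray:
  fixes \<Sigma> :: "real ^ 'm ^ 'm" and m c :: "real ^ 'm"
  assumes "transpose \<Sigma> = \<Sigma>" "positive_definite \<Sigma>" and c: "c \<in> positive_orthant"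
  defines "z \<equiv> (\<chi> i. ln (c $ i) - m $ i)"
    and "V \<equiv> inverse (1 \<bullet> (matrix_inv \<Sigma> *v 1))"
  shows "(\<integral>\<^sup>+ t. ennreal (t ^ (CARD('m) - 1)) * ennreal (lognormal_density m \<Sigma> (t *\<^sub>R c))
             * indicator {0<..} t \<partial>lborel) =
     ennreal (sqrt (2 * pi * V)
       / (sqrt \<bar>det \<Sigma>\<bar> * (2 * pi) powr (real CARD('m) / 2) * (\<Prod>i\<in>UNIV. c $ i))
       * exp (- (1 / 2) * (z \<bullet> (matrix_inv \<Sigma> *v z) - V * (1 \<bullet> (matrix_inv \<Sigma> *v z))\<^sup>2)))"
proof -
  define S where "S = matrix_inv \<Sigma>"
  define q where "q v = v \<bullet> (S *v v)" for v
  define K where "K = sqrt \<bar>det \<Sigma>\<bar> * (2 * pi) powr (real CARD('m) / 2) * (\<Prod>i\<in>UNIV. c $ i)"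
  define \<mu> where "\<mu> = - V * (1 \<bullet> (S *v z))"
  define R where "R = z \<bullet> (S *v z) - V * (1 \<bullet> (S *v z))\<^sup>2"
  have inv: "invertible \<Sigma>"
    using assms(2) by (rule positive_definite_imp_invertible)
  have "(1 :: real ^ 'm) \<noteq> 0"
    by (simp add: vec_eq_iff)
  then have "0 < 1 \<bullet> (S *v 1)"
    using positive_definite_matrix_inv[OF assms(2)] by (simp add: positive_definite_def S_def)
  then have "0 < V" and square: "q (z + u *\<^sub>R 1) = R + (u - \<mu>)\<^sup>2 / V" for u
    unfolding V_def q_def R_def \<mu>_def S_def[symmetric]
    using inner_matrix_inv_commute[OF assms(1) inv]
    by (simp_all add: complete_square_along_ones S_def)
  have c_pos: "0 < c $ i" for i
    using c by (simp add: positive_orthant_def)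
  have "0 < K"
    using inv c_pos by (auto simp: K_def invertible_det_nz intro!: mult_pos_pos prod_pos)
  have card: "Suc (CARD('m) - 1) = CARD('m)"
    by simp
  have density: "exp u ^ (CARD('m) - 1) * lognormal_density m \<Sigma> (exp u *\<^sub>R c) * exp u
      = exp (- (1 / 2) * q (z + u *\<^sub>R 1)) / K" for u
  proof -
    have "(\<chi> i. ln ((exp u *\<^sub>R c) $ i) - m $ i) = z + u *\<^sub>R 1"
      using c_pos by (simp add: vec_eq_iff z_def ln_mult less_imp_neq[THEN not_sym])
    then have d: "lognormal_density m \<Sigma> (exp u *\<^sub>R c)
        = exp (- (1 / 2) * q (z + u *\<^sub>R 1)) / (K * exp u ^ CARD('m))"
      by (simp add: lognormal_density_def Let_def K_def q_def S_def prod.distrib mult_ac)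
    have "exp u ^ (CARD('m) - 1) * lognormal_density m \<Sigma> (exp u *\<^sub>R c) * exp u
        = exp u ^ Suc (CARD('m) - 1) * lognormal_density m \<Sigma> (exp u *\<^sub>R c)"
      by (simp only: power_Suc mult_ac)
    also have "\<dots> = exp (- (1 / 2) * q (z + u *\<^sub>R 1)) / K"
      unfolding card d by simp
    finally show ?thesis .
  qed
  have nonneg: "0 \<le> lognormal_density m \<Sigma> (exp u *\<^sub>R c)" for u
    unfolding lognormal_density_def Let_def
    by (intro divide_nonneg_nonneg mult_nonneg_nonneg prod_nonneg ballI)
       (auto simp: c_pos less_imp_le)
  have "(\<integral>\<^sup>+ t. ennreal (t ^ (CARD('m) - 1)) * ennreal (lognormal_density m \<Sigma> (t *\<^sub>R c))
             * indicator {0<..} t \<partial>lborel) =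
     (\<integral>\<^sup>+ u. ennreal (exp u ^ (CARD('m) - 1)) * ennreal (lognormal_density m \<Sigma> (exp u *\<^sub>R c))
             * ennreal (exp u) \<partial>lborel)"
    by (rule nn_integral_exp_substitution) measurable
  also have "\<dots> = (\<integral>\<^sup>+ u. ennreal (exp (- (1 / 2) * R) / K)
                   * ennreal (exp (- ((u - \<mu>)\<^sup>2) / (2 * V))) \<partial>lborel)"
  proof (rule nn_integral_cong)
    fix u
    have "ennreal (exp u ^ (CARD('m) - 1)) * ennreal (lognormal_density m \<Sigma> (exp u *\<^sub>R c)) * ennreal (exp u)
        = ennreal (exp (- (1 / 2) * q (z + u *\<^sub>R 1)) / K)"
      by (subst density[symmetric]) (simp add: ennreal_mult nonneg)
    also have "exp (- (1 / 2) * q (z + u *\<^sub>R 1)) / K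
        = exp (- (1 / 2) * R) / K * exp (- ((u - \<mu>)\<^sup>2) / (2 * V))"
      by (simp add: square exp_add[symmetric] field_simps)
    also have "ennreal (exp (- (1 / 2) * R) / K * exp (- ((u - \<mu>)\<^sup>2) / (2 * V)))
        = ennreal (exp (- (1 / 2) * R) / K) * ennreal (exp (- ((u - \<mu>)\<^sup>2) / (2 * V)))"
      using \<open>0 < K\<close> by (intro ennreal_mult) simp_all
    finally show "ennreal (exp u ^ (CARD('m) - 1)) * ennreal (lognormal_density m \<Sigma> (exp u *\<^sub>R c)) * ennreal (exp u)
        = ennreal (exp (- (1 / 2) * R) / K) * ennreal (exp (- ((u - \<mu>)\<^sup>2) / (2 * V)))" .
  qed
  also have "\<dots> = ennreal (exp (- (1 / 2) * R) / K) * ennreal (sqrt (2 * pi * V))"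
    unfolding nn_integral_gaussian[OF \<open>0 < V\<close>, where \<mu> = \<mu>, symmetric] by (rule nn_integral_cmult) measurable
  also have "\<dots> = ennreal (sqrt (2 * pi * V) / K * exp (- (1 / 2) * R))"
    using \<open>0 < K\<close> \<open>0 < V\<close> by (simp add: ennreal_mult[symmetric] mult.commute)
  finally show ?thesis
    by (simp only: K_def R_def S_def)
qed

section \<open>The density of the pushforward\<close>

lemma space_simplex_measure [simp]: "space simplex_measure = open_unit_simplex"
  by (simp add: simplex_measure_def space_restrict_space)

lemma sets_simplex_measure [simp]:
  "sets simplex_measure = sets (restrict_space borel open_unit_simplex)"
  by (simp add: simplex_measure_def)

lemma nn_integral_simplex_measure:
  fixes f :: "real ^ ('n::finite) option \<Rightarrow> ennreal"
  assumes f: "f \<in> borel_measurable (restrict_space borel open_unit_simplex)"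
  shows "(\<integral>\<^sup>+ y. f y \<partial>simplex_measure) =
    (\<integral>\<^sup>+ x. ennreal (sqrt (real CARD('n) + 1)) * f (simplex_completion x)
          * indicator open_corner_simplex x \<partial>lborel)"
proof -
  have "(\<lambda>x. f (simplex_completion x)) \<in> borel_measurable (restrict_space lborel open_corner_simplex)"
    by (rule measurable_compose[OF measurable_simplex_completion f])
  then show ?thesis
    using f unfolding simplex_measure_def
    by (subst nn_integral_distr)
       (auto simp: nn_integral_density nn_integral_restrict_space)
qed

lemma finite_measure_simplex_measure:
  "finite_measure (simplex_measure :: (real ^ ('n::finite) option) measure)"
proof
  have "(open_corner_simplex :: (real ^ 'n) set) \<subseteq> cbox 0 1"
    by (auto simp: open_corner_simplex_def mem_box_cart less_imp_le)
  then have "emeasure lborel (open_corner_simplex :: (real ^ 'n) set) < \<infinity>"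
    by (intro emeasure_bounded_finite) (rule bounded_subset[OF bounded_cbox])
  then have "(\<integral>\<^sup>+ y. 1 \<partial>(simplex_measure :: (real ^ 'n option) measure)) < \<infinity>"
    by (subst nn_integral_simplex_measure) (simp_all add: nn_integral_cmult_indicator ennreal_mult_less_top)
  then show "emeasure simplex_measure (space (simplex_measure :: (real ^ 'n option) measure)) \<noteq> \<infinity>"
    by simp
qed

lemma homogeneous_transform_borel [measurable]:
  "(homogeneous_transform :: real ^ 'm \<Rightarrow> _) \<in> borel_measurable borel"
  by (rule borel_measurable_vecI) (simp add: homogeneous_transform_def)

lemma homogeneous_transform_scaleR_simplex_completion:
  assumes "t \<noteq> 0"
  shows "homogeneous_transform (t *\<^sub>R simplex_completion x) = simplex_completion x"
proof -
  have "(\<Sum>k\<in>UNIV. simplex_completion x $ k) = 1"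
    by (simp add: sum_UNIV_option)
  then show ?thesis
    using assms by (simp add: homogeneous_transform_def vec_eq_iff sum_distrib_left[symmetric])
qed

theorem proposition3p1:
  fixes \<Sigma> :: "real ^ ('n::finite) option ^ 'n option"
    and m :: "real ^ ('n::finite) option"
    and g :: "real ^ ('n::finite) option \<Rightarrow> real"
    and V :: real
    and Q X Y :: "real ^ 'n \<Rightarrow> real"
    and w :: "real ^ 'n \<Rightarrow> real ^ ('n::finite) option"
    and P :: "(real ^ ('n::finite) option) measure"
  assumes "transpose \<Sigma> = \<Sigma>" and "positive_definite \<Sigma>"
    and V: "V = inverse (1 \<bullet> (matrix_inv \<Sigma> *v 1))"
    and w: "\<And>x. w x = (\<chi> k. case k of
              Some i \<Rightarrow> ln (x $ i) - m $ Some i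
            | None \<Rightarrow> ln (1 - (\<Sum>i\<in>UNIV. x $ i)) - m $ None)"
    and Q: "\<And>x. Q x = sqrt \<bar>det \<Sigma>\<bar> * (2 * pi) powr ((real CARD('n) + 1) / 2)
              * (1 - (\<Sum>i\<in>UNIV. x $ i)) * (\<Prod>i\<in>UNIV. x $ i)"
    and X: "\<And>x. X x = 1 \<bullet> (matrix_inv \<Sigma> *v w x)"
    and Y: "\<And>x. Y x = w x \<bullet> (matrix_inv \<Sigma> *v w x)"
    and g: "\<And>x. x \<in> open_corner_simplex \<Longrightarrow>
              g (simplex_completion x) =
                sqrt (2 * pi * V) / (Q x * sqrt (real CARD('n) + 1))
                * exp (- (1 / 2) * (Y x - V * (X x)\<^sup>2))"
    and P: "P = distr (lognormal_distribution m \<Sigma>)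
                  (restrict_space borel open_unit_simplex) homogeneous_transform"
  shows "absolutely_continuous simplex_measure P
       \<and> g \<in> borel_measurable simplex_measure
       \<and> P = density simplex_measure (\<lambda>y. ennreal (g y))
       \<and> (AE y in simplex_measure. RN_deriv simplex_measure P y = ennreal (g y))"
proof -
  define h where "h x = sqrt (2 * pi * V) / (Q x * sqrt (real CARD('n) + 1))
                * exp (- (1 / 2) * (Y x - V * (X x)\<^sup>2))" for x
  have [measurable]: "w \<in> borel_measurable borel"
  proof (rule borel_measurable_vecI)
    show "(\<lambda>x. w x $ k) \<in> borel_measurable borel" for k
      by (cases k) (simp_all add: w)
  qed
  have [measurable]: "(*v) (matrix_inv \<Sigma>) \<in> borel_measurable borel"
    by (intro borel_measurable_continuous_onI linear_continuous_on) simp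
  have [measurable]: "h \<in> borel_measurable borel"
    unfolding h_def Q X Y by measurable
  have [measurable]: "(\<lambda>y :: real ^ 'n option. \<chi> i. y $ Some i) \<in> borel_measurable borel"
    by (rule borel_measurable_vecI) simp
  \<comment> \<open>The values of \<open>g\<close> are prescribed on the simplex only.  There \<open>g\<close> agrees with the
    measurable function \<open>h\<close> of the first \<open>n\<close> coordinates.\<close>
  have g_h: "g y = h (\<chi> i. y $ Some i)" if y: "y \<in> open_unit_simplex" for y
  proof -
    obtain x where "x \<in> open_corner_simplex" "y = simplex_completion x"
      using y bij_betw_simplex_completion by (metis bij_betw_imp_surj_on imageE)
    then show ?thesis
      by (simp add: g h_def)
  qed
  have g_meas: "g \<in> borel_measurable (restrict_space borel open_unit_simplex)"
  proof (subst measurable_cong[OF g_h])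
    show "(\<lambda>y. h (\<chi> i. y $ Some i)) \<in> borel_measurable (restrict_space borel open_unit_simplex)"
      by (rule measurable_restrict_space1) measurable
  qed (simp add: space_restrict_space)
  then have g_meas': "g \<in> borel_measurable simplex_measure"
    by (simp cong: measurable_cong_sets)

  \<comment> \<open>The factor \<open>sqrt (n + 1)\<close> is the density of the surface measure in the coordinates \<open>x\<close>.\<close>
  have ray: "(\<integral>\<^sup>+ t. ennreal (t ^ CARD('n)) * ennreal (lognormal_density m \<Sigma> (t *\<^sub>R simplex_completion x))
        * indicator {0<..} t \<partial>lborel) = ennreal (sqrt (real CARD('n) + 1)) * ennreal (g (simplex_completion x))"
    if x: "x \<in> open_corner_simplex" for x
  proof -
    have "simplex_completion x \<in> positive_orthant"
      using scaleR_simplex_completion_in_positive_orthant_iff[of 1 x] x by simp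
    note * = nn_integral_lognormal_density_ray[OF \<open>transpose \<Sigma> = \<Sigma>\<close> \<open>positive_definite \<Sigma>\<close> this, of m]
    have z: "(\<chi> k. ln (simplex_completion x $ k) - m $ k) = w x"
      by (simp add: w vec_eq_iff split_option_all)
    have q: "sqrt \<bar>det \<Sigma>\<bar> * (2 * pi) powr (real CARD('n option) / 2) * (\<Prod>k\<in>UNIV. simplex_completion x $ k) = Q x"
      by (simp add: Q prod_UNIV_option add.commute)
    have "sqrt (2 * pi * V) / Q x * exp (- (1 / 2) * (Y x - V * (X x)\<^sup>2))
        = sqrt (real CARD('n) + 1) * g (simplex_completion x)"
      using x by (simp add: g)
    then show ?thesis
      using * unfolding z q V[symmetric] X[symmetric] Y[symmetric]
      by (simp add: ennreal_mult'[symmetric])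
  qed

  have dens: "P = density simplex_measure (\<lambda>y. ennreal (g y))"
  proof (rule measure_eqI)
    show "sets P = sets (density simplex_measure (\<lambda>y. ennreal (g y)))"
      by (simp add: P)
    fix A
    assume "A \<in> sets P"
    then have A': "A \<in> sets (restrict_space borel open_unit_simplex)"
      by (simp add: P)
    then have [measurable]: "A \<in> sets borel"
      by (simp add: sets_restrict_space_iff)
    have H: "homogeneous_transform \<in> lognormal_distribution m \<Sigma> \<rightarrow>\<^sub>M restrict_space borel open_unit_simplex"
      using measurable_homogeneous_transform
      by (simp add: lognormal_distribution_def cong: measurable_cong_sets)
    have "emeasure P A = (\<integral>\<^sup>+ z. indicator A z \<partial>P)"
      using \<open>A \<in> sets P\<close> by simp
    also have "\<dots> = (\<integral>\<^sup>+ y. indicator A (homogeneous_transform y) \<partial>lognormal_distribution m \<Sigma>)"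
      using A' unfolding P by (intro nn_integral_distr H) simp
    also have "\<dots> = (\<integral>\<^sup>+ y. ennreal (lognormal_density m \<Sigma> y) * indicator A (homogeneous_transform y)
                       * indicator positive_orthant y \<partial>lborel)"
      unfolding lognormal_distribution_def
      by (subst nn_integral_density)
         (auto simp: nn_integral_restrict_space intro!: measurable_restrict_space1)
    also have "\<dots> = (\<integral>\<^sup>+ x. (\<integral>\<^sup>+ t. ennreal (t ^ CARD('n)) *
         (ennreal (lognormal_density m \<Sigma> (t *\<^sub>R simplex_completion x))
            * indicator A (homogeneous_transform (t *\<^sub>R simplex_completion x)))
         * indicator {0<..} t \<partial>lborel) * indicator open_corner_simplex x \<partial>lborel)"
      by (rule nn_integral_homogeneous_coordinates) measurable
    also have "\<dots> = (\<integral>\<^sup>+ x. ennreal (sqrt (real CARD('n) + 1)) *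
         (ennreal (g (simplex_completion x)) * indicator A (simplex_completion x))
         * indicator open_corner_simplex x \<partial>lborel)"
    proof (rule nn_integral_cong)
      fix x :: "real ^ 'n"
      have "(\<integral>\<^sup>+ t. ennreal (t ^ CARD('n)) *
         (ennreal (lognormal_density m \<Sigma> (t *\<^sub>R simplex_completion x))
            * indicator A (homogeneous_transform (t *\<^sub>R simplex_completion x)))
         * indicator {0<..} t \<partial>lborel) =
         (\<integral>\<^sup>+ t. ennreal (t ^ CARD('n)) * ennreal (lognormal_density m \<Sigma> (t *\<^sub>R simplex_completion x))
            * indicator {0<..} t * indicator A (simplex_completion x) \<partial>lborel)"
        by (intro nn_integral_cong)
           (auto simp: homogeneous_transform_scaleR_simplex_completion mult_ac split: split_indicator)
      also have "\<dots> = (\<integral>\<^sup>+ t. ennreal (t ^ CARD('n)) * ennreal (lognormal_density m \<Sigma> (t *\<^sub>R simplex_completion x))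
            * indicator {0<..} t \<partial>lborel) * indicator A (simplex_completion x)"
        by (rule nn_integral_multc) measurable
      finally show "(\<integral>\<^sup>+ t. ennreal (t ^ CARD('n)) *
         (ennreal (lognormal_density m \<Sigma> (t *\<^sub>R simplex_completion x))
            * indicator A (homogeneous_transform (t *\<^sub>R simplex_completion x)))
         * indicator {0<..} t \<partial>lborel) * indicator open_corner_simplex x =
         ennreal (sqrt (real CARD('n) + 1)) *
         (ennreal (g (simplex_completion x)) * indicator A (simplex_completion x))
         * indicator open_corner_simplex x"
        using ray[of x] by (simp add: mult.assoc split: split_indicator)
    qed
    also have "\<dots> = (\<integral>\<^sup>+ y. ennreal (g y) * indicator A y \<partial>simplex_measure)"
      using g_meas A' by (subst nn_integral_simplex_measure) auto
    also have "\<dots> = emeasure (density simplex_measure (\<lambda>y. ennreal (g y))) A"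
      using g_meas' A' by (subst emeasure_density) auto
    finally show "emeasure P A = emeasure (density simplex_measure (\<lambda>y. ennreal (g y))) A" .
  qed

  interpret finite_measure "simplex_measure :: (real ^ 'n option) measure"
    by (rule finite_measure_simplex_measure)
  have "AE y in simplex_measure. ennreal (g y) = RN_deriv simplex_measure P y"
    using g_meas' dens by (intro RN_deriv_unique) auto
  moreover have "absolutely_continuous simplex_measure P"
    unfolding dens using g_meas' by (intro absolutely_continuousI_density) simp
  ultimately show ?thesis
    using g_meas' dens by (auto simp: eq_commute)
qed

end
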